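(* For every integer $k\ge 3$, there exists a connected semi-symmetric graph of order $4k^2$ with valency $2k(k-1)$. In particular, writing the order as $2n$ and the valency as $d$, the ratio $d/n=(k-1)/k$, which tends to $1$ as $k\to\infty$.
   Context: All graphs are simple and undirected. A graph is semi-symmetric if it is regular and edge-transitive (its automorphism group is transitive on edges) but not vertex-transitive. *)

theory Defs
  imports Complex_Main "Graph_Theory.Graph_Theory"
begin

text \<open>
  Simple undirected graphs are represented, as in the Graph\_Theory entry, by the locale
  \<^locale>\<open>graph\<close>: finite symmetric digraphs without loops and parallel arcs. An undirected
  edge \<open>{u, v}\<close> is thus a pair of opposite arcs, so the valency of a vertex is its out-degree.
\<close>

definition regular_of_valency :: "('a, 'b) pre_digraph \<Rightarrow> nat \<Rightarrow> bool" where
  "regular_of_valency G d \<longleftrightarrow> (\<forall>v \<in> verts G. out_degree G v = d)"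

definition automorphism ::
    "('a, 'b) pre_digraph \<Rightarrow> ('a, 'b, 'a, 'b) digraph_isomorphism \<Rightarrow> bool" where
  "automorphism G f \<longleftrightarrow> pre_digraph.digraph_isomorphism G f \<and> app_iso f G = G"

definition vertex_transitive :: "('a, 'b) pre_digraph \<Rightarrow> bool" where
  "vertex_transitive G \<longleftrightarrow>
     (\<forall>u \<in> verts G. \<forall>v \<in> verts G. \<exists>f. automorphism G f \<and> iso_verts f u = v)"

text \<open>
  Transitivity is on undirected edges, not on arcs: the automorphism is allowed to send
  \<open>tail G a\<close> to \<open>head G b\<close>.
\<close>

definition edge_transitive :: "('a, 'b) pre_digraph \<Rightarrow> bool" where
  "edge_transitive G \<longleftrightarrow>
     (\<forall>a \<in> arcs G. \<forall>b \<in> arcs G. \<exists>f. automorphism G f \<and>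
        iso_verts f ` {tail G a, head G a} = {tail G b, head G b})"

definition semi_symmetric :: "('a, 'b) pre_digraph \<Rightarrow> bool" where
  "semi_symmetric G \<longleftrightarrow>
     (\<exists>d. regular_of_valency G d) \<and> edge_transitive G \<and> \<not> vertex_transitive G"

end

theory Submission
  imports Defs
begin

text \<open>
  Take the \<open>k\<^sup>2\<close> cells of the \<open>k \<times> k\<close> grid, each in two copies, against the \<open>2 k\<close> rows and columns,
  each in \<open>k\<close> copies, and join a cell to a line if and only if the line misses the cell. The
  symmetries of the grid act transitively on the pairs of a cell and a line missing it, and the
  copies can be permuted freely, so this graph is edge-transitive. It is not vertex-transitive,
  since a cell has just one twin (another vertex with the same neighbours), whereas a line has at
  least \<open>k - 1 \<ge> 2\<close>.
\<close>

section \<open>Graphs on countable types\<close>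

text \<open>The vertices used below are structured data, while the theorem fixes the vertex type
  \<open>nat\<close>; the injection \<open>to_nat\<close> transports the graph. Taking pairs as arcs
  rules out parallel ones.\<close>

definition nat_graph :: "'v::countable set \<Rightarrow> ('v \<Rightarrow> 'v \<Rightarrow> bool) \<Rightarrow> (nat, nat \<times> nat) pre_digraph" where
  "nat_graph V E = \<lparr>verts = to_nat ` V,
     arcs = {(to_nat u, to_nat v) | u v. u \<in> V \<and> v \<in> V \<and> E u v}, tail = fst, head = snd\<rparr>"

lemma nat_graph_simps [simp]:
  "verts (nat_graph V E) = to_nat ` V"
  "arcs (nat_graph V E) = {(to_nat u, to_nat v) | u v. u \<in> V \<and> v \<in> V \<and> E u v}"
  "tail (nat_graph V E) = fst"
  "head (nat_graph V E) = snd"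
  by (simp_all add: nat_graph_def)

lemma card_verts_nat_graph: "card (verts (nat_graph V E)) = card V"
  by (simp add: card_image)

lemma nat_graph_dominates_iff:
  "to_nat u \<rightarrow>\<^bsub>nat_graph V E\<^esub> to_nat v \<longleftrightarrow> u \<in> V \<and> v \<in> V \<and> E u v"
  by (force simp: arcs_ends_conv)

lemma graph_nat_graph:
  assumes "finite V" "symp E" "irreflp E"
  shows "graph (nat_graph V E)"
proof -
  have "arcs (nat_graph V E) \<subseteq> to_nat ` V \<times> to_nat ` V"
    by auto
  then have "finite (arcs (nat_graph V E))"
    by (rule finite_subset) (use assms(1) in simp)
  moreover have "symmetric (nat_graph V E)"
    using assms(2) by (force simp: symmetric_conv dest: sympD)
  moreover have "\<not> E v v" for v
    using assms(3) by (rule irreflpD)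
  ultimately show ?thesis
    using assms(1) by unfold_locales (auto simp: arc_to_ends_def)
qed

lemma out_degree_nat_graph:
  assumes "v \<in> V"
  shows "out_degree (nat_graph V E) (to_nat v) = card {w \<in> V. E v w}"
proof -
  have "out_arcs (nat_graph V E) (to_nat v) = (\<lambda>w. (to_nat v, to_nat w)) ` {w \<in> V. E v w}"
    using assms by (auto simp: out_arcs_def)
  moreover have "inj_on (\<lambda>w. (to_nat v, to_nat w)) {w \<in> V. E v w}"
    by (auto intro: inj_onI)
  ultimately show ?thesis
    by (simp add: out_degree_def card_image)
qed

text \<open>An adjacency-preserving permutation \<open>g\<close> of \<open>V\<close> is all that has
  to be given: its action on the codes of vertices and on pairs of codes supplies the rest of the
  isomorphism record.\<close>

lemma nat_graph_automorphismI:
  assumes "graph (nat_graph V E)"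
    and bij: "bij_betw g V V" and E: "\<And>u v. u \<in> V \<Longrightarrow> v \<in> V \<Longrightarrow> E (g u) (g v) \<longleftrightarrow> E u v"
  obtains f where "automorphism (nat_graph V E) f" "\<And>v. iso_verts f (to_nat v) = to_nat (g v)"
proof -
  define h where "h n = (to_nat (g (from_nat n)) :: nat)" for n
  \<comment> \<open>The end maps stay \<open>fst\<close> and \<open>snd\<close>, since
    \<open>app_iso f G = G\<close> demands equality of graphs.\<close>
  define f where "f = \<lparr>iso_verts = h, iso_arcs = map_prod h h, iso_head = snd, iso_tail = fst\<rparr>"
  have h: "h (to_nat v) = to_nat (g v)" for v
    by (simp add: h_def)
  have inj: "inj_on g V" and img: "g ` V = V"
    using bij by (auto simp: bij_betw_def)
  have "inj_on h (to_nat ` V)"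
    using inj by (auto simp: inj_on_def h)
  moreover have "inj_on (map_prod h h) (arcs (nat_graph V E))"
    using inj by (auto simp: inj_on_def h)
  moreover have "h ` to_nat ` V = to_nat ` V"
    by (metis (no_types, lifting) h image_cong image_image img)
  moreover have "map_prod h h ` arcs (nat_graph V E) = arcs (nat_graph V E)"
  proof (intro equalityI subsetI)
    fix a assume "a \<in> map_prod h h ` arcs (nat_graph V E)"
    then obtain u v where "u \<in> V" "v \<in> V" "E u v" "a = (to_nat (g u), to_nat (g v))"
      by (auto simp: h)
    with E img show "a \<in> arcs (nat_graph V E)"
      by auto
  next
    fix a assume "a \<in> arcs (nat_graph V E)"
    then obtain u v where uv: "u \<in> V" "v \<in> V" "E u v" "a = (to_nat u, to_nat v)"
      by auto
    then have "u \<in> g ` V" "v \<in> g ` V"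
      by (simp_all only: img)
    then obtain u' v' where "u' \<in> V" "v' \<in> V" "u = g u'" "v = g v'"
      by blast
    with uv E have "a = map_prod h h (to_nat u', to_nat v')"
      "(to_nat u', to_nat v') \<in> arcs (nat_graph V E)"
      by (auto simp: h)
    then show "a \<in> map_prod h h ` arcs (nat_graph V E)"
      by blast
  qed
  moreover have "wf_digraph (nat_graph V E)"
    by unfold_locales auto
  ultimately have "automorphism (nat_graph V E) f"
    by (simp add: automorphism_def pre_digraph.digraph_isomorphism_def app_iso_def f_def
      pre_digraph.equality del: nat_graph_simps(2))
  then show thesis
    using h that by (auto simp: f_def)
qed

text \<open>\<open>connected\<close> asks for strong connectedness of the symmetric closure, in
  which every walk of \<open>G\<close> survives.\<close>

lemma (in wf_digraph) strongly_connected_imp_connected: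
  assumes "strongly_connected G"
  shows "connected G"
  using assms unfolding connected_def strongly_connected_def with_proj_simps pverts_mk_symmetric
  by (blast intro: reachable_mk_symmetricI)


section \<open>Twins\<close>

text \<open>A vertex counts as its own twin here, so the sizes compared below are at most 2 for a
  cell and at least \<open>k\<close> for a line.\<close>

definition twins :: "('a, 'b) pre_digraph \<Rightarrow> 'a \<Rightarrow> 'a set" where
  "twins G u = {w \<in> verts G. \<forall>x \<in> verts G. w \<rightarrow>\<^bsub>G\<^esub> x \<longleftrightarrow> u \<rightarrow>\<^bsub>G\<^esub> x}"

text \<open>Since \<open>app_iso f G = G\<close>, \<open>iso_arcs f\<close> maps the arcs onto
  themselves: arcs push forward, and an arc between images pulls back to one whose ends are
  \<open>u\<close> and \<open>v\<close> by injectivity on vertices.\<close>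

lemma automorphism_dominates_iff:
  assumes "automorphism G f" "u \<in> verts G" "v \<in> verts G"
  shows "iso_verts f u \<rightarrow>\<^bsub>G\<^esub> iso_verts f v \<longleftrightarrow> u \<rightarrow>\<^bsub>G\<^esub> v"
proof -
  have iso: "pre_digraph.digraph_isomorphism G f" and fix_G: "app_iso f G = G"
    using assms(1) by (auto simp: automorphism_def)
  have wf: "wf_digraph G" and inj: "inj_on (iso_verts f) (verts G)"
    and ends: "\<And>a. a \<in> arcs G \<Longrightarrow> iso_verts f (tail G a) = tail G (iso_arcs f a) \<and>
      iso_verts f (head G a) = head G (iso_arcs f a)"
    using iso arg_cong[OF fix_G, of tail] arg_cong[OF fix_G, of head]
    by (auto simp: pre_digraph.digraph_isomorphism_def)
  have arcs: "arcs G = iso_arcs f ` arcs G"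
    using arg_cong[OF fix_G, of arcs] by simp
  show ?thesis
  proof
    assume "iso_verts f u \<rightarrow>\<^bsub>G\<^esub> iso_verts f v"
    then obtain b where "b \<in> arcs G" "tail G b = iso_verts f u" "head G b = iso_verts f v"
      by blast
    moreover from this arcs obtain a where "a \<in> arcs G" "b = iso_arcs f a"
      by blast
    ultimately have "tail G a = u" "head G a = v"
      using ends inj assms wf by (metis inj_onD wf_digraph.wellformed)+
    with \<open>a \<in> arcs G\<close> show "u \<rightarrow>\<^bsub>G\<^esub> v"
      by (auto simp: arcs_ends_conv)
  next
    assume "u \<rightarrow>\<^bsub>G\<^esub> v"
    then obtain a where "a \<in> arcs G" "tail G a = u" "head G a = v"
      by blast
    with ends arcs show "iso_verts f u \<rightarrow>\<^bsub>G\<^esub> iso_verts f v"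
      by (auto simp: arcs_ends_conv intro: rev_image_eqI)
  qed
qed

text \<open>An automorphism maps twins of \<open>u\<close> injectively to twins of its image: as it
  is onto, the twin condition at any \<open>z\<close> reduces to the one at a preimage of
  \<open>z\<close>.\<close>

lemma automorphism_card_twins_le:
  assumes "automorphism G f" "finite (verts G)" "u \<in> verts G"
  shows "card (twins G u) \<le> card (twins G (iso_verts f u))"
proof (rule card_inj_on_le)
  have img: "iso_verts f ` verts G = verts G"
    using assms(1) by (metis automorphism_def verts_app_iso)
  show "inj_on (iso_verts f) (twins G u)"
    using assms(1)
    by (auto simp: automorphism_def twins_def pre_digraph.digraph_isomorphism_def inj_on_def)
  show "finite (twins G (iso_verts f u))"
    using assms(2) by (simp add: twins_def)
  show "iso_verts f ` twins G u \<subseteq> twins G (iso_verts f u)"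
  proof
    fix y assume "y \<in> iso_verts f ` twins G u"
    then obtain w where w: "w \<in> verts G" "y = iso_verts f w"
      and nbrs: "\<And>x. x \<in> verts G \<Longrightarrow> w \<rightarrow>\<^bsub>G\<^esub> x \<longleftrightarrow> u \<rightarrow>\<^bsub>G\<^esub> x"
      by (auto simp: twins_def)
    have "y \<rightarrow>\<^bsub>G\<^esub> z \<longleftrightarrow> iso_verts f u \<rightarrow>\<^bsub>G\<^esub> z" if "z \<in> verts G" for z
    proof -
      have "z \<in> iso_verts f ` verts G"
        using that by (simp only: img)
      then obtain x where "x \<in> verts G" "z = iso_verts f x"
        by blast
      with w nbrs show ?thesis
        using automorphism_dominates_iff[OF assms(1)] assms(3) by simp
    qed
    moreover have "y \<in> iso_verts f ` verts G"
      using w by blast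
    then have "y \<in> verts G"
      by (simp only: img)
    ultimately show "y \<in> twins G (iso_verts f u)"
      unfolding twins_def by blast
  qed
qed

lemma twins_nat_graph:
  assumes "u \<in> V"
  shows "twins (nat_graph V E) (to_nat u) = to_nat ` {w \<in> V. \<forall>x \<in> V. E w x \<longleftrightarrow> E u x}"
proof -
  have "(\<forall>x \<in> V. to_nat w \<rightarrow>\<^bsub>nat_graph V E\<^esub> to_nat x \<longleftrightarrow> to_nat u \<rightarrow>\<^bsub>nat_graph V E\<^esub> to_nat x) \<longleftrightarrow>
      (\<forall>x \<in> V. E w x \<longleftrightarrow> E u x)" if "w \<in> V" for w
    using assms that by (simp add: nat_graph_dominates_iff)
  then show ?thesis
    unfolding twins_def nat_graph_simps ball_simps by blast
qed


section \<open>The graph of cells and lines missing them\<close>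

text \<open>
  \<open>Inl (i, j, c)\<close> is copy \<open>c\<close> of the cell \<open>(i, j)\<close>; \<open>Inr (t, r, m)\<close> is copy \<open>m\<close> of column \<open>r\<close> if \<open>t\<close>
  holds, and of row \<open>r\<close> otherwise.
\<close>

type_synonym grid_vertex = "nat \<times> nat \<times> bool + bool \<times> nat \<times> nat"

definition grid_verts :: "nat \<Rightarrow> grid_vertex set" where
  "grid_verts k = ({..<k} \<times> {..<k} \<times> UNIV) <+> (UNIV \<times> {..<k} \<times> {..<k})"

text \<open>\<open>if t then j else i\<close> is the index of the line in direction \<open>t\<close>
  through the cell. Copy numbers are ignored, so copies are twins.\<close>

fun misses :: "grid_vertex \<Rightarrow> grid_vertex \<Rightarrow> bool" where
  "misses (Inl (i, j, c)) (Inr (t, r, m)) \<longleftrightarrow> r \<noteq> (if t then j else i)"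
| "misses (Inr (t, r, m)) (Inl (i, j, c)) \<longleftrightarrow> r \<noteq> (if t then j else i)"
| "misses _ _ \<longleftrightarrow> False"

abbreviation grid_graph :: "nat \<Rightarrow> (nat, nat \<times> nat) pre_digraph" where
  "grid_graph k \<equiv> nat_graph (grid_verts k) misses"

lemma grid_verts_iff [simp]:
  "Inl (i, j, c) \<in> grid_verts k \<longleftrightarrow> i < k \<and> j < k"
  "Inr (t, r, m) \<in> grid_verts k \<longleftrightarrow> r < k \<and> m < k"
  by (auto simp: grid_verts_def)

section \<open>Order and valency of the graph\<close>

lemma finite_grid_verts: "finite (grid_verts k)"
  by (simp add: grid_verts_def)

lemma card_grid_verts: "card (grid_verts k) = 4 * k ^ 2"
  by (simp add: grid_verts_def card_Plus card_cartesian_product power2_eq_square)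

lemma misses_sym: "misses u v \<longleftrightarrow> misses v u"
  by (cases "(u, v)" rule: misses.cases) auto

lemma graph_grid_graph: "graph (grid_graph k)"
proof (rule graph_nat_graph)
  show "irreflp misses"
  proof (rule irreflpI)
    show "\<not> misses v v" for v by (cases v) auto
  qed
qed (auto simp: finite_grid_verts misses_sym intro: sympI)

text \<open>The numbers of copies balance the two sides: a cell misses \<open>2 * (k - 1)\<close>
  lines with \<open>k\<close> copies each, a line misses \<open>k * (k - 1)\<close> cells with 2
  copies each.\<close>

lemma regular_grid_graph: "regular_of_valency (grid_graph k) (2 * k * (k - 1))"
proof -
  have "card {w \<in> grid_verts k. misses v w} = 2 * k * (k - 1)" if v: "v \<in> grid_verts k" for v
  proof (cases v)
    case (Inl p)
    obtain i j c where p: "p = (i, j, c)" by (cases p)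
    have "{w \<in> grid_verts k. misses v w} =
        Inr ` (SIGMA t:UNIV. ({..<k} - {if t then j else i}) \<times> {..<k})"
      by (auto simp: grid_verts_def Inl p)
    then show ?thesis
      using v by (simp add: card_image UNIV_bool Inl p)
  next
    case (Inr l)
    obtain t r m where l: "l = (t, r, m)" by (cases l)
    have "{w \<in> grid_verts k. misses v w} = Inl ` (if t
        then {..<k} \<times> ({..<k} - {r}) \<times> UNIV else ({..<k} - {r}) \<times> {..<k} \<times> UNIV)"
      by (auto simp: grid_verts_def Inr l)
    then show ?thesis
      using v by (simp add: card_image card_cartesian_product Inr l)
  qed
  then show ?thesis
    by (auto simp: regular_of_valency_def out_degree_nat_graph)
qed

section \<open>Connectedness\<close>

text \<open>Of three indices one avoids any two given ones, so two cells always have a common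
  neighbouring row; and every line has some cell as a neighbour.\<close>

lemma strongly_connected_grid_graph:
  assumes "k \<ge> 3"
  shows "strongly_connected (grid_graph k)"
proof -
  interpret graph "grid_graph k" by (rule graph_grid_graph)
  have third: "\<exists>r<k. r \<noteq> x \<and> r \<noteq> y" for x y :: nat
  proof -
    have "\<exists>r \<in> {0, 1, 2::nat}. r \<noteq> x \<and> r \<noteq> y"
      by auto
    with assms show ?thesis by (auto intro: exI[of _ "0::nat"] exI[of _ "1::nat"] exI[of _ "2::nat"])
  qed
  have cells: "to_nat (Inl p :: grid_vertex) \<rightarrow>\<^sup>*\<^bsub>grid_graph k\<^esub> to_nat (Inl q :: grid_vertex)"
    if pq: "Inl p \<in> grid_verts k" "Inl q \<in> grid_verts k" for p q
  proof -
    obtain i j c i' j' c' where [simp]: "p = (i, j, c)" "q = (i', j', c')"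
      by (cases p, cases q)
    obtain r where "r < k" "r \<noteq> i" "r \<noteq> i'"
      using third by blast
    then have "to_nat (Inl p :: grid_vertex) \<rightarrow>\<^bsub>grid_graph k\<^esub> to_nat (Inr (False, r, 0) :: grid_vertex)"
      "to_nat (Inr (False, r, 0) :: grid_vertex) \<rightarrow>\<^bsub>grid_graph k\<^esub> to_nat (Inl q :: grid_vertex)"
      using pq by (auto simp: nat_graph_dominates_iff)
    then show ?thesis
      by (meson adj_reachable_trans reachable_adjI)
  qed
  have to_cell: "\<exists>p. Inl p \<in> grid_verts k \<and> to_nat v \<rightarrow>\<^sup>*\<^bsub>grid_graph k\<^esub> to_nat (Inl p :: grid_vertex)"
    if v: "v \<in> grid_verts k" for v
  proof (cases v)
    case (Inl p)
    with v show ?thesis by (intro exI[of _ p]) simp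
  next
    case (Inr l)
    obtain t r m where l: "l = (t, r, m)" by (cases l)
    \<comment> \<open>A diagonal cell off index \<open>r\<close> misses row \<open>r\<close> and
      column \<open>r\<close> alike, so \<open>t\<close> needs no case distinction.\<close>
    obtain s where "s < k" "s \<noteq> r"
      using third by blast
    then have "to_nat v \<rightarrow>\<^bsub>grid_graph k\<^esub> to_nat (Inl (s, s, True) :: grid_vertex)"
      using v by (auto simp: nat_graph_dominates_iff Inr l)
    with \<open>s < k\<close> show ?thesis
      by (metis grid_verts_iff(1) reachable_adjI)
  qed
  have "to_nat u \<rightarrow>\<^sup>*\<^bsub>grid_graph k\<^esub> to_nat v" if uv: "u \<in> grid_verts k" "v \<in> grid_verts k" for u v
    using to_cell[OF uv(1)] to_cell[OF uv(2)] cells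
    by (meson reachable_trans symmetric_reachable')
  then have "\<forall>u \<in> verts (grid_graph k). \<forall>v \<in> verts (grid_graph k). u \<rightarrow>\<^sup>*\<^bsub>grid_graph k\<^esub> v"
    unfolding nat_graph_simps by blast
  moreover have "Inl (0, 0, True) \<in> grid_verts k"
    using assms by simp
  then have "verts (grid_graph k) \<noteq> {}"
    unfolding nat_graph_simps by blast
  ultimately show ?thesis
    unfolding strongly_connected_def by blast
qed

section \<open>Failure of vertex-transitivity\<close>

lemma not_vertex_transitive_grid_graph:
  assumes "k \<ge> 3"
  shows "\<not> vertex_transitive (grid_graph k)"
proof
  let ?cell = "Inl (0, 0, True) :: grid_vertex" and ?row = "Inr (False, 0, 0) :: grid_vertex"
  assume "vertex_transitive (grid_graph k)"
  moreover have "to_nat ?row \<in> verts (grid_graph k)" "to_nat ?cell \<in> verts (grid_graph k)"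
    using assms by simp_all
  \<comment> \<open>The line is sent to the cell, not conversely: an automorphism cannot shrink the
    set of twins.\<close>
  ultimately obtain f where
    f: "automorphism (grid_graph k) f" "iso_verts f (to_nat ?row) = to_nat ?cell"
    unfolding vertex_transitive_def by blast
  have "{w \<in> grid_verts k. \<forall>x \<in> grid_verts k. misses w x \<longleftrightarrow> misses ?cell x} \<subseteq>
      {Inl (0, 0, False), ?cell}"
  proof (rule subsetI)
    fix w assume w: "w \<in> {w \<in> grid_verts k. \<forall>x \<in> grid_verts k. misses w x \<longleftrightarrow> misses ?cell x}"
    then have nbrs: "misses w x \<longleftrightarrow> misses ?cell x" if "x \<in> grid_verts k" for x
      using that by blast
    show "w \<in> {Inl (0, 0, False), ?cell}"
    proof (cases w)
      case (Inl p)
      obtain i j c where p: "p = (i, j, c)" by (cases p)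
      \<comment> \<open>Row 0 and column 0 are the lines through the cell, hence not neighbours of a
        twin of it.\<close>
      have "i = 0" "j = 0"
        using nbrs[of "Inr (False, 0, 0)"] nbrs[of "Inr (True, 0, 0)"] assms by (auto simp: Inl p)
      then show ?thesis by (auto simp: Inl p)
    next
      case (Inr l)
      \<comment> \<open>Row 1 is a neighbour of the cell, but two lines are never adjacent.\<close>
      then show ?thesis
        using nbrs[of "Inr (False, 1, 0)"] assms by auto
    qed
  qed
  then have "card {w \<in> grid_verts k. \<forall>x \<in> grid_verts k. misses w x \<longleftrightarrow> misses ?cell x} \<le>
      card {Inl (0, 0, False), ?cell}"
    by (rule card_mono[rotated]) simp
  then have "card (twins (grid_graph k) (to_nat ?cell)) \<le> 2"
    using assms by (simp add: twins_nat_graph card_image)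
  moreover have "(\<lambda>m. Inr (False, 0, m)) ` {..<k} \<subseteq>
      {w \<in> grid_verts k. \<forall>x \<in> grid_verts k. misses w x \<longleftrightarrow> misses ?row x}"
  proof -
    have "misses (Inr (False, 0, m)) x \<longleftrightarrow> misses ?row x" for m x
      by (cases "(?row, x)" rule: misses.cases) auto
    then show ?thesis by auto
  qed
  then have "card ((\<lambda>m. Inr (False, 0, m) :: grid_vertex) ` {..<k}) \<le>
      card (twins (grid_graph k) (to_nat ?row))"
    using assms by (simp add: twins_nat_graph card_image card_mono finite_grid_verts)
  then have "k \<le> card (twins (grid_graph k) (to_nat ?row))"
    by (simp add: card_image inj_on_def)
  moreover have "card (twins (grid_graph k) (to_nat ?row)) \<le> card (twins (grid_graph k) (to_nat ?cell))"
    using automorphism_card_twins_le[OF f(1), of "to_nat ?row"] f(2) assms by (simp add: finite_grid_verts)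
  ultimately show False
    using assms by simp
qed

section \<open>Symmetries of the grid and edge-transitivity\<close>

text \<open>The first transposition sends \<open>x\<close> to \<open>x'\<close>; the second takes
  the image of \<open>y\<close> to \<open>y'\<close> and fixes \<open>x'\<close>, which differs from
  both.\<close>

lemma permutes_pair:
  assumes "x \<in> A" "y \<in> A" "x \<noteq> y" "x' \<in> A" "y' \<in> A" "x' \<noteq> y'"
  obtains p where "bij_betw p A A" "p x = x'" "p y = y'"
proof
  let ?q = "transpose x x'"
  let ?p = "transpose (?q y) y' \<circ> ?q"
  show "bij_betw ?p A A"
    using assms by (intro bij_betw_trans[of _ A A] bij_betw_transpose_iff)
      (auto simp: transpose_def)
  show "?p x = x'" "?p y = y'"
    using assms by (auto simp: transpose_def)
qed

text \<open>\<open>p\<close> permutes the rows, \<open>q\<close> the columns and \<open>h\<close>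
  the copies of each line; \<open>s\<close> then transposes the grid, and \<open>d\<close> swaps the
  two copies of each cell.\<close>

fun grid_map :: "(nat \<Rightarrow> nat) \<Rightarrow> (nat \<Rightarrow> nat) \<Rightarrow> (nat \<Rightarrow> nat) \<Rightarrow> bool \<Rightarrow> bool \<Rightarrow> grid_vertex \<Rightarrow> grid_vertex"
where
  "grid_map p q h s d (Inl (i, j, c)) = Inl (if s then q j else p i, if s then p i else q j, c \<noteq> d)"
| "grid_map p q h s d (Inr (t, r, m)) = Inr (t \<noteq> s, if t then q r else p r, h m)"

lemma grid_map_automorphism:
  assumes p: "bij_betw p {..<k} {..<k}" and q: "bij_betw q {..<k} {..<k}"
    and h: "bij_betw h {..<k} {..<k}"
  obtains f where "automorphism (grid_graph k) f"
    "\<And>v. iso_verts f (to_nat v) = to_nat (grid_map p q h s d v)"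
proof -
  let ?g = "grid_map p q h s d"
  have lt: "p x < k" "q x < k" "h x < k" if "x < k" for x
    using that p q h bij_betwE by blast+
  have eq: "p x = p y \<longleftrightarrow> x = y" "q x = q y \<longleftrightarrow> x = y" "h x = h y \<longleftrightarrow> x = y"
    if "x < k" "y < k" for x y
    using that p q h by (auto simp: bij_betw_def inj_on_def)
  have "?g v \<in> grid_verts k" if "v \<in> grid_verts k" for v
    using that by (cases "(p, q, h, s, d, v)" rule: grid_map.cases) (auto simp: lt)
  moreover have inj: "inj_on ?g (grid_verts k)"
  proof (rule inj_onI)
    fix u v assume "u \<in> grid_verts k" "v \<in> grid_verts k" "?g u = ?g v"
    then show "u = v"
      by (cases "(p, q, h, s, d, u)" rule: grid_map.cases;
          cases "(p, q, h, s, d, v)" rule: grid_map.cases) (auto simp: eq split: if_splits)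
  qed
  \<comment> \<open>An injective self-map of a finite set is onto.\<close>
  ultimately have "bij_betw ?g (grid_verts k) (grid_verts k)"
    unfolding bij_betw_def by (intro conjI endo_inj_surj finite_grid_verts) auto
  moreover have "misses (?g u) (?g v) \<longleftrightarrow> misses u v" if "u \<in> grid_verts k" "v \<in> grid_verts k" for u v
    using that by (cases "(u, v)" rule: misses.cases) (auto simp: eq)
  ultimately show thesis
    using nat_graph_automorphismI[OF graph_grid_graph] that by blast
qed

lemma edge_transitive_grid_graph: "edge_transitive (grid_graph k)"
proof -
  have flags: "\<exists>f. automorphism (grid_graph k) f \<and>
      iso_verts f (to_nat (Inl (i, j, c) :: grid_vertex)) = to_nat (Inl (i', j', c') :: grid_vertex) \<and>
      iso_verts f (to_nat (Inr (t, r, m) :: grid_vertex)) = to_nat (Inr (t', r', m') :: grid_vertex)"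
    if flag: "i < k" "j < k" "r < k" "m < k" "r \<noteq> (if t then j else i)"
      "i' < k" "j' < k" "r' < k" "m' < k" "r' \<noteq> (if t' then j' else i')"
    for i j r m i' j' r' m' :: nat and c t c' t' :: bool
  proof -
    \<comment> \<open>\<open>?on t i j\<close> is the cell coordinate that is compared with the line
      index \<open>r\<close>, and \<open>?on t j i\<close> is the other one. So \<open>p\<close>
      must move two distinct indices to prescribed places, while \<open>q\<close> has a single value
      to match.\<close>
    let ?on = "\<lambda>t i j :: nat. if t then j else i"
    have "?on t i j \<in> {..<k}" "r \<in> {..<k}" "?on t i j \<noteq> r"
      "?on t' i' j' \<in> {..<k}" "r' \<in> {..<k}" "?on t' i' j' \<noteq> r'"
      using flag by auto
    then obtain p where p: "bij_betw p {..<k} {..<k}" "p (?on t i j) = ?on t' i' j'" "p r = r'"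
      by (rule permutes_pair)
    define q where "q = transpose (?on t j i) (?on t' j' i')"
    define h where "h = transpose m m'"
    have q: "bij_betw q {..<k} {..<k}" "q (?on t j i) = ?on t' j' i'"
      and h: "bij_betw h {..<k} {..<k}" "h m = m'"
      using flag by (auto simp: q_def h_def)
    \<comment> \<open>\<open>p\<close> belongs to direction \<open>t\<close>, so it acts on columns
      if \<open>t\<close> holds and on rows otherwise. The grid is transposed exactly when the two
      directions differ.\<close>
    have "bij_betw (if t then q else p) {..<k} {..<k}" "bij_betw (if t then p else q) {..<k} {..<k}"
      using p(1) q(1) by simp_all
    then obtain f where f: "automorphism (grid_graph k) f"
      "\<And>v. iso_verts f (to_nat v) =
        to_nat (grid_map (if t then q else p) (if t then p else q) h (t \<noteq> t') (c \<noteq> c') v)"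
      using h(1) by (rule grid_map_automorphism[where s = "t \<noteq> t'" and d = "c \<noteq> c'"]) blast
    have "grid_map (if t then q else p) (if t then p else q) h (t \<noteq> t') (c \<noteq> c') (Inl (i, j, c)) =
        Inl (i', j', c')"
      using p(2) q(2) by (cases t; cases t') auto
    moreover have "grid_map (if t then q else p) (if t then p else q) h (t \<noteq> t') (c \<noteq> c')
        (Inr (t, r, m)) = Inr (t', r', m')"
      using p(3) h(2) by (cases t; cases t') auto
    ultimately show ?thesis
      using f by (intro exI[of _ f]) simp
  qed
  \<comment> \<open>An arc may start at either end; as an unordered pair its ends can be listed cell
    first, so no automorphism need exchange cells and lines.\<close>
  have ends: "\<exists>i j c t r m. i < k \<and> j < k \<and> r < k \<and> m < k \<and> r \<noteq> (if t then j else i) \<and>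
      {tail (grid_graph k) a, head (grid_graph k) a} =
        {to_nat (Inl (i, j, c) :: grid_vertex), to_nat (Inr (t, r, m) :: grid_vertex)}"
    if "a \<in> arcs (grid_graph k)" for a
  proof -
    obtain u v where uv: "u \<in> grid_verts k" "v \<in> grid_verts k" "misses u v" "a = (to_nat u, to_nat v)"
      using \<open>a \<in> arcs (grid_graph k)\<close> by auto
    then consider i j c t r m where "u = Inl (i, j, c)" "v = Inr (t, r, m)"
      | i j c t r m where "u = Inr (t, r, m)" "v = Inl (i, j, c)"
      by (cases "(u, v)" rule: misses.cases) auto
    then show ?thesis
    proof cases
      case (1 i j c t r m)
      with uv show ?thesis
        by (intro exI[of _ i] exI[of _ j] exI[of _ c] exI[of _ t] exI[of _ r] exI[of _ m]) simp
    next
      case (2 i j c t r m)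
      with uv show ?thesis
        by (intro exI[of _ i] exI[of _ j] exI[of _ c] exI[of _ t] exI[of _ r] exI[of _ m])
          (simp add: insert_commute)
    qed
  qed
  show ?thesis
    unfolding edge_transitive_def
  proof (intro ballI)
    fix a b assume ab: "a \<in> arcs (grid_graph k)" "b \<in> arcs (grid_graph k)"
    obtain i j c t r m where a: "i < k" "j < k" "r < k" "m < k" "r \<noteq> (if t then j else i)"
      "{tail (grid_graph k) a, head (grid_graph k) a} =
        {to_nat (Inl (i, j, c) :: grid_vertex), to_nat (Inr (t, r, m) :: grid_vertex)}"
      using ends[OF ab(1)] by blast
    obtain i' j' c' t' r' m' where b: "i' < k" "j' < k" "r' < k" "m' < k" "r' \<noteq> (if t' then j' else i')"
      "{tail (grid_graph k) b, head (grid_graph k) b} =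
        {to_nat (Inl (i', j', c') :: grid_vertex), to_nat (Inr (t', r', m') :: grid_vertex)}"
      using ends[OF ab(2)] by blast
    show "\<exists>f. automorphism (grid_graph k) f \<and> iso_verts f ` {tail (grid_graph k) a, head (grid_graph k) a}
        = {tail (grid_graph k) b, head (grid_graph k) b}"
      unfolding a(6) b(6) using flags[OF a(1-5) b(1-5), of c c']
      by (elim exE conjE) (rule exI, rule conjI, assumption, simp)
  qed
qed


theorem theorem6p1:
  shows "(\<forall>k::nat. k \<ge> 3 \<longrightarrow>
           (\<exists>G :: (nat, nat \<times> nat) pre_digraph.
              graph G \<and> Digraph_Component.connected G \<and> semi_symmetric G \<and>
              card (verts G) = 4 * k ^ 2 \<and> regular_of_valency G (2 * k * (k - 1)) \<and>
              (\<forall>n d. card (verts G) = 2 * n \<and> regular_of_valency G d \<longrightarrow>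
                 real d / real n = (real k - 1) / real k)))
       \<and> (\<lambda>k::nat. (real k - 1) / real k) \<longlonglongrightarrow> 1"
proof (intro conjI allI impI)
  fix k :: nat assume k: "k \<ge> 3"
  have card: "card (verts (grid_graph k)) = 4 * k ^ 2"
    by (simp only: card_verts_nat_graph card_grid_verts)
  have ratio: "real d / real n = (real k - 1) / real k"
    if "card (verts (grid_graph k)) = 2 * n" "regular_of_valency (grid_graph k) d" for n d
  proof -
    have "n = 2 * k ^ 2"
      using that(1) card by linarith
    \<comment> \<open>Some vertex must exist for regularity to determine \<open>d\<close>.\<close>
    moreover have "to_nat (Inl (0, 0, True) :: grid_vertex) \<in> verts (grid_graph k)"
      using k by simp
    then have "d = 2 * k * (k - 1)"
      using that(2) regular_grid_graph[of k] unfolding regular_of_valency_def by metis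
    ultimately show ?thesis
      using k by (simp add: power2_eq_square field_simps)
  qed
  have "wf_digraph (grid_graph k)"
    by unfold_locales auto
  then have "Digraph_Component.connected (grid_graph k)"
    using strongly_connected_grid_graph[OF k] by (rule wf_digraph.strongly_connected_imp_connected)
  then show "\<exists>G :: (nat, nat \<times> nat) pre_digraph.
      graph G \<and> Digraph_Component.connected G \<and> semi_symmetric G \<and>
      card (verts G) = 4 * k ^ 2 \<and> regular_of_valency G (2 * k * (k - 1)) \<and>
      (\<forall>n d. card (verts G) = 2 * n \<and> regular_of_valency G d \<longrightarrow>
         real d / real n = (real k - 1) / real k)"
    using graph_grid_graph regular_grid_graph edge_transitive_grid_graph
      not_vertex_transitive_grid_graph[OF k] card ratio
    unfolding semi_symmetric_def by blast
next
  have "(\<lambda>k::nat. 1 - 1 / real k) \<longlonglongrightarrow> 1 - 0"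
    by (intro tendsto_diff tendsto_const lim_1_over_n)
  \<comment> \<open>The two forms differ at \<open>k = 0\<close>, where division by 0 gives 0, so
    the equality is stated only eventually.\<close>
  moreover have "eventually (\<lambda>k::nat. 1 - 1 / real k = (real k - 1) / real k) sequentially"
    using eventually_gt_at_top[of 0] by eventually_elim (simp add: field_simps)
  ultimately show "(\<lambda>k::nat. (real k - 1) / real k) \<longlonglongrightarrow> 1"
    by (simp add: tendsto_cong)
qed

end
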